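(* Let $A,B\in\mathbf{Gr}^{\bullet}$ and let $\beta=(\beta_{+},\beta_{\ast},\beta_{\ast^{\circ}})$ be a triple of actions of $B$ on $A$, written $\beta_+(b,a)=b\cdot a$, $\beta_\ast(b,a)=a^{b}$, $\beta_{\ast^\circ}(b,a)=b^{a}$. Then the following conditions are equivalent: (1) $\beta$ is a triple of derived actions of $B$ on $A$. (2) $\beta_+$ satisfies the group action conditions $b\cdot(a_1+a_2)=b\cdot a_1+b\cdot a_2$, $(b_1+b_2)\cdot a=b_1\cdot(b_2\cdot a)$, $0_B\cdot a=a$ for all $a,a_1,a_2\in A$, $b,b_1,b_2\in B$; the condition $a^{0_B}=a$ holds for all $a\in A$; and for all $a,a'\in A$, $b,b'\in B$: $(1_A)$ $(a+a')^{b}=a^{b}+(a')^{b}$, $(2_A)$ $(b+b')^{a}=b^{a}+b\cdot\left((b')^{a}\right)$, $(3_A)$ $(b\cdot a)^{a'}+b^{a'}=b^{a'}+b\cdot\left(a^{a'}\right)$, $(4_A)$ $(b\cdot a)^{b'}=b^{b'}\cdot a^{b'}$, $(1_B)$ $b^{(a+a')}=\left(b^{a}\right)^{a'}+b^{a'}$, $(2_B)$ $a^{b+b'}=\left(a^{b}\right)^{b'}$, $(3_B)$ $\left(a^{(b\cdot a')}\right)^{b}=\left(a^{b}\right)^{a'}$, $(4_B)$ $\left(b^{(b'\cdot a)}\right)^{b'}=\left(b^{b'}\right)^{a}$. (3) The semi-direct product $B\ltimes A$ is an object in $\mathbf{Gr}^{\bullet}$.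
   Context: Groups are written additively but need not be commutative. An object of the category $\mathbf{Gr}^{\bullet}$ (groups with action on itself) is a group $G$ with a map $G\times G\to G$, $(g,h)\mapsto g^{h}$, such that $g^{g'+g''}=(g^{g'})^{g''}$, $g^{0}=g$ and $(g'+g'')^{g}=g'^{g}+g''^{g}$ for all $g,g',g''\in G$. Morphisms are group homomorphisms $\varphi$ with $\varphi(g^{h})=\varphi(g)^{\varphi(h)}$. For $A,B\in\mathbf{Gr}^{\bullet}$, a triple of actions of $B$ on $A$ is a triple $\beta=(\beta_{+},\beta_{\ast},\beta_{\ast^{\circ}})$ of maps $B\times A\to A$, written $\beta_+(b,a)=b\cdot a$, $\beta_\ast(b,a)=a^{b}$, $\beta_{\ast^\circ}(b,a)=b^{a}$; all three values lie in $A$ (so for $a\in A$, $b\in B$ both $a^b$ and $b^a$ are elements of $A$, while $a^{a'}\in A$ and $b^{b'}\in B$ denote the given actions in $A$ and in $B$). $0_A,0_B$ are the zero elements of $A$ and $B$. A split extension of $B$ by $A$ in $\mathbf{Gr}^{\bullet}$ is a sequence $0\to A\xrightarrow{i}E\xrightarrow{p}B\to 0$ in $\mathbf{Gr}^{\bullet}$ with $p$ surjective, $i$ the kernel of $p$, together with a morphism $j\colon B\to E$ with $pj=1_B$. Identifying $i(a)$ with $a$, it induces a triple of actions of $B$ on $A$ by $$b\cdot a=j(b)+a-j(b),\qquad b^{a}=j(b)^{a}-j(b),\qquad a^{b}=a^{j(b)}.$$ A triple of actions is called a triple of derived actions if it is induced in this way by some split extension of $B$ by $A$ in $\mathbf{Gr}^{\bullet}$.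 Given a triple of actions of $B$ on $A$, the semi-direct product $B\ltimes A$ is the set $B\times A$ with the operations $$(b,a)+(b',a')=(b+b',\,a+b\cdot a'),\qquad (b,a)^{(b',a')}=\left(b^{b'},\,(a^{a'})^{b'}+(b^{a'})^{b'}\right).$$
   Formalization: (3) implies (1),(2) only under the added hypothesis 0_A^b = 0_A for all b in B, with (0_B,0_A) taken as the zero of B⋉A; without it the claim fails: A=B=Z/2 with trivial self-actions, b·a=a, a^b=a+b, b^a=0. (1)⇔(2) and (2)⇒(3) are unconditional. *)

theory Defs
  imports "HOL-Algebra.Coset"
begin

(* The groups are not assumed commutative, so the library's multiplicative notation for groups is
   used: \<otimes>, \<one>, inv stand for the +, 0, - of the additively written theory.  An action value
   g^h is written g \<Up> h. *)

record 'a gr_bullet = "'a monoid" +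
  act :: "'a \<Rightarrow> 'a \<Rightarrow> 'a" (infixl \<open>\<Up>\<index>\<close> 75)

locale gr_bullet = group G for G (structure) +
  assumes act_closed: "\<lbrakk>g \<in> carrier G; h \<in> carrier G\<rbrakk> \<Longrightarrow> g \<Up> h \<in> carrier G"
    and act_mult: "\<lbrakk>g \<in> carrier G; g' \<in> carrier G; g'' \<in> carrier G\<rbrakk> \<Longrightarrow>
      g \<Up> (g' \<otimes> g'') = (g \<Up> g') \<Up> g''"
    and act_one: "g \<in> carrier G \<Longrightarrow> g \<Up> \<one> = g"
    and mult_act: "\<lbrakk>g \<in> carrier G; g' \<in> carrier G; g'' \<in> carrier G\<rbrakk> \<Longrightarrow>
      (g' \<otimes> g'') \<Up> g = (g' \<Up> g) \<otimes> (g'' \<Up> g)"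

definition gr_hom :: "('a, 'm) gr_bullet_scheme \<Rightarrow> ('b, 'n) gr_bullet_scheme \<Rightarrow> ('a \<Rightarrow> 'b) set"
  where "gr_hom G H = {\<phi> \<in> hom G H. \<forall>g\<in>carrier G. \<forall>h\<in>carrier G.
    \<phi> (g \<Up>\<^bsub>G\<^esub> h) = \<phi> g \<Up>\<^bsub>H\<^esub> \<phi> h}"

(* For \<beta> = (\<beta>_+, \<beta>_*, \<beta>_o), with b in B and a in A:
     b \<cdot> a  is  \<beta>_+(b, a);
     a \<star> b  is  a^b = \<beta>_*(b, a), the arguments being taken in the order of the notation a^b;
     b \<diamondop> a  is  b^a = \<beta>_o(b, a). *)
record ('b, 'a) action_triple =
  act_dot :: "'b \<Rightarrow> 'a \<Rightarrow> 'a" (infixr \<open>\<cdot>\<index>\<close> 75)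
  act_star :: "'a \<Rightarrow> 'b \<Rightarrow> 'a" (infixl \<open>\<star>\<index>\<close> 75)
  act_circ :: "'b \<Rightarrow> 'a \<Rightarrow> 'a" (infixl \<open>\<diamondop>\<index>\<close> 75)

definition triple_of_actions ::
  "('b, 'm) gr_bullet_scheme \<Rightarrow> ('a, 'n) gr_bullet_scheme \<Rightarrow> ('b, 'a) action_triple \<Rightarrow> bool"
  where "triple_of_actions B A \<beta> \<longleftrightarrow>
    (\<forall>b\<in>carrier B. \<forall>a\<in>carrier A.
       b \<cdot>\<^bsub>\<beta>\<^esub> a \<in> carrier A \<and> a \<star>\<^bsub>\<beta>\<^esub> b \<in> carrier A \<and> b \<diamondop>\<^bsub>\<beta>\<^esub> a \<in> carrier A)"

definition split_extension ::
  "('b, 'm) gr_bullet_scheme \<Rightarrow> ('a, 'n) gr_bullet_scheme \<Rightarrow> ('e, 'k) gr_bullet_scheme \<Rightarrow>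
    ('a \<Rightarrow> 'e) \<Rightarrow> ('e \<Rightarrow> 'b) \<Rightarrow> ('b \<Rightarrow> 'e) \<Rightarrow> bool"
  where "split_extension B A E i p j \<longleftrightarrow>
    gr_bullet E \<and> i \<in> gr_hom A E \<and> p \<in> gr_hom E B \<and> j \<in> gr_hom B E \<and>
    inj_on i (carrier A) \<and> i ` carrier A = kernel E B p \<and>
    p ` carrier E = carrier B \<and> (\<forall>b\<in>carrier B. p (j b) = b)"

definition induced_actions ::
  "('b, 'm) gr_bullet_scheme \<Rightarrow> ('a, 'n) gr_bullet_scheme \<Rightarrow> ('e, 'k) gr_bullet_scheme \<Rightarrow>
    ('a \<Rightarrow> 'e) \<Rightarrow> ('b \<Rightarrow> 'e) \<Rightarrow> ('b, 'a) action_triple \<Rightarrow> bool"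
  where "induced_actions B A E i j \<beta> \<longleftrightarrow>
    (\<forall>b\<in>carrier B. \<forall>a\<in>carrier A.
       i (b \<cdot>\<^bsub>\<beta>\<^esub> a) = j b \<otimes>\<^bsub>E\<^esub> i a \<otimes>\<^bsub>E\<^esub> inv\<^bsub>E\<^esub> (j b) \<and>
       i (b \<diamondop>\<^bsub>\<beta>\<^esub> a) = (j b \<Up>\<^bsub>E\<^esub> i a) \<otimes>\<^bsub>E\<^esub> inv\<^bsub>E\<^esub> (j b) \<and>
       i (a \<star>\<^bsub>\<beta>\<^esub> b) = i a \<Up>\<^bsub>E\<^esub> j b)"

(* HOL cannot quantify over the type of E inside a definition.  Up to isomorphism the underlying set
   of E may be taken inside 'b \<times> 'a; the lemma derived_actionsI shows that split extensions over
   arbitrary types give no further triples. *)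
definition derived_actions ::
  "('b, 'm) gr_bullet_scheme \<Rightarrow> ('a, 'n) gr_bullet_scheme \<Rightarrow> ('b, 'a) action_triple \<Rightarrow> bool"
  where "derived_actions B A \<beta> \<longleftrightarrow>
    (\<exists>(E :: ('b \<times> 'a) gr_bullet) i p j.
       split_extension B A E i p j \<and> induced_actions B A E i j \<beta>)"

definition action_conditions ::
  "('b, 'm) gr_bullet_scheme \<Rightarrow> ('a, 'n) gr_bullet_scheme \<Rightarrow> ('b, 'a) action_triple \<Rightarrow> bool"
  where "action_conditions B A \<beta> \<longleftrightarrow>
    (\<forall>b\<in>carrier B. \<forall>a1\<in>carrier A. \<forall>a2\<in>carrier A.
       b \<cdot>\<^bsub>\<beta>\<^esub> (a1 \<otimes>\<^bsub>A\<^esub> a2) = (b \<cdot>\<^bsub>\<beta>\<^esub> a1) \<otimes>\<^bsub>A\<^esub> (b \<cdot>\<^bsub>\<beta>\<^esub> a2)) \<and>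
    (\<forall>b1\<in>carrier B. \<forall>b2\<in>carrier B. \<forall>a\<in>carrier A.
       (b1 \<otimes>\<^bsub>B\<^esub> b2) \<cdot>\<^bsub>\<beta>\<^esub> a = b1 \<cdot>\<^bsub>\<beta>\<^esub> (b2 \<cdot>\<^bsub>\<beta>\<^esub> a)) \<and>
    (\<forall>a\<in>carrier A. \<one>\<^bsub>B\<^esub> \<cdot>\<^bsub>\<beta>\<^esub> a = a) \<and>
    (\<forall>a\<in>carrier A. a \<star>\<^bsub>\<beta>\<^esub> \<one>\<^bsub>B\<^esub> = a) \<and>
    (\<forall>a\<in>carrier A. \<forall>a'\<in>carrier A. \<forall>b\<in>carrier B. \<forall>b'\<in>carrier B.
       (a \<otimes>\<^bsub>A\<^esub> a') \<star>\<^bsub>\<beta>\<^esub> b = (a \<star>\<^bsub>\<beta>\<^esub> b) \<otimes>\<^bsub>A\<^esub> (a' \<star>\<^bsub>\<beta>\<^esub> b) \<and>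
       (b \<otimes>\<^bsub>B\<^esub> b') \<diamondop>\<^bsub>\<beta>\<^esub> a = (b \<diamondop>\<^bsub>\<beta>\<^esub> a) \<otimes>\<^bsub>A\<^esub> (b \<cdot>\<^bsub>\<beta>\<^esub> (b' \<diamondop>\<^bsub>\<beta>\<^esub> a)) \<and>
       ((b \<cdot>\<^bsub>\<beta>\<^esub> a) \<Up>\<^bsub>A\<^esub> a') \<otimes>\<^bsub>A\<^esub> (b \<diamondop>\<^bsub>\<beta>\<^esub> a') = (b \<diamondop>\<^bsub>\<beta>\<^esub> a') \<otimes>\<^bsub>A\<^esub> (b \<cdot>\<^bsub>\<beta>\<^esub> (a \<Up>\<^bsub>A\<^esub> a')) \<and>
       (b \<cdot>\<^bsub>\<beta>\<^esub> a) \<star>\<^bsub>\<beta>\<^esub> b' = (b \<Up>\<^bsub>B\<^esub> b') \<cdot>\<^bsub>\<beta>\<^esub> (a \<star>\<^bsub>\<beta>\<^esub> b') \<and>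
       b \<diamondop>\<^bsub>\<beta>\<^esub> (a \<otimes>\<^bsub>A\<^esub> a') = ((b \<diamondop>\<^bsub>\<beta>\<^esub> a) \<Up>\<^bsub>A\<^esub> a') \<otimes>\<^bsub>A\<^esub> (b \<diamondop>\<^bsub>\<beta>\<^esub> a') \<and>
       a \<star>\<^bsub>\<beta>\<^esub> (b \<otimes>\<^bsub>B\<^esub> b') = (a \<star>\<^bsub>\<beta>\<^esub> b) \<star>\<^bsub>\<beta>\<^esub> b' \<and>
       (a \<Up>\<^bsub>A\<^esub> (b \<cdot>\<^bsub>\<beta>\<^esub> a')) \<star>\<^bsub>\<beta>\<^esub> b = (a \<star>\<^bsub>\<beta>\<^esub> b) \<Up>\<^bsub>A\<^esub> a' \<and>
       (b \<diamondop>\<^bsub>\<beta>\<^esub> (b' \<cdot>\<^bsub>\<beta>\<^esub> a)) \<star>\<^bsub>\<beta>\<^esub> b' = (b \<Up>\<^bsub>B\<^esub> b') \<diamondop>\<^bsub>\<beta>\<^esub> a)"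

definition semidirect_product ::
  "('b, 'm) gr_bullet_scheme \<Rightarrow> ('a, 'n) gr_bullet_scheme \<Rightarrow> ('b, 'a) action_triple \<Rightarrow>
    ('b \<times> 'a) gr_bullet"
  where "semidirect_product B A \<beta> =
    \<lparr>carrier = carrier B \<times> carrier A,
     mult = (\<lambda>(b, a) (b', a'). (b \<otimes>\<^bsub>B\<^esub> b', a \<otimes>\<^bsub>A\<^esub> (b \<cdot>\<^bsub>\<beta>\<^esub> a'))),
     one = (\<one>\<^bsub>B\<^esub>, \<one>\<^bsub>A\<^esub>),
     act = (\<lambda>(b, a) (b', a').
       (b \<Up>\<^bsub>B\<^esub> b', ((a \<Up>\<^bsub>A\<^esub> a') \<star>\<^bsub>\<beta>\<^esub> b') \<otimes>\<^bsub>A\<^esub> ((b \<diamondop>\<^bsub>\<beta>\<^esub> a') \<star>\<^bsub>\<beta>\<^esub> b')))\<rparr>"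

lemma derived_actionsI:
  fixes A :: "('a, 'n) gr_bullet_scheme" and B :: "('b, 'm) gr_bullet_scheme"
    and E :: "('e, 'k) gr_bullet_scheme"
  assumes A: "gr_bullet A" and B: "gr_bullet B"
    and ext: "split_extension B A E i p j" and ind: "induced_actions B A E i j \<beta>"
  shows "derived_actions B A \<beta>"
proof -
  interpret A: gr_bullet A by (rule A)
  interpret B: gr_bullet B by (rule B)
  interpret E: gr_bullet E using ext by (simp add: split_extension_def)
  have ihom: "i \<in> hom A E" and iact: "\<And>a a'. \<lbrakk>a \<in> carrier A; a' \<in> carrier A\<rbrakk> \<Longrightarrow> i (a \<Up>\<^bsub>A\<^esub> a') = i a \<Up>\<^bsub>E\<^esub> i a'"
    and phom: "p \<in> hom E B" and pact: "\<And>x y. \<lbrakk>x \<in> carrier E; y \<in> carrier E\<rbrakk> \<Longrightarrow> p (x \<Up>\<^bsub>E\<^esub> y) = p x \<Up>\<^bsub>B\<^esub> p y"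
    and jhom: "j \<in> hom B E" and jact: "\<And>b b'. \<lbrakk>b \<in> carrier B; b' \<in> carrier B\<rbrakk> \<Longrightarrow> j (b \<Up>\<^bsub>B\<^esub> b') = j b \<Up>\<^bsub>E\<^esub> j b'"
    and iinj: "inj_on i (carrier A)" and iker: "i ` carrier A = kernel E B p"
    and psurj: "p ` carrier E = carrier B" and pj: "\<And>b. b \<in> carrier B \<Longrightarrow> p (j b) = b"
    using ext by (auto simp: split_extension_def gr_hom_def)
  interpret p: group_hom E B p using phom by unfold_locales
  interpret j: group_hom B E j using jhom by unfold_locales
  have ic: "i a \<in> carrier E" if "a \<in> carrier A" for a using ihom that by (auto simp: hom_def)
  have im: "i (a \<otimes>\<^bsub>A\<^esub> a') = i a \<otimes>\<^bsub>E\<^esub> i a'" if "a \<in> carrier A" "a' \<in> carrier A" for a a'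
    using ihom that by (auto simp: hom_def)
  define h where "h x = (p x, inv_into (carrier A) i (x \<otimes>\<^bsub>E\<^esub> inv\<^bsub>E\<^esub> (j (p x))))" for x
  have h_inj: "inj_on h (carrier E)"
  proof (rule inj_onI)
    fix x y assume x: "x \<in> carrier E" and y: "y \<in> carrier E" and eq: "h x = h y"
    have ker: "z \<otimes>\<^bsub>E\<^esub> inv\<^bsub>E\<^esub> (j (p z)) \<in> i ` carrier A" if "z \<in> carrier E" for z
      using that by (simp add: iker kernel_def pj)
    have "x \<otimes>\<^bsub>E\<^esub> inv\<^bsub>E\<^esub> (j (p x)) = y \<otimes>\<^bsub>E\<^esub> inv\<^bsub>E\<^esub> (j (p y))"
      by (rule inv_into_injective[OF _ ker[OF x] ker[OF y]]) (use eq in \<open>auto simp: h_def\<close>)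
    moreover have "p x = p y" using eq by (simp add: h_def)
    ultimately show "x = y" using x y by simp
  qed
  define k where "k = inv_into (carrier E) h"
  have kh: "k (h x) = x" if "x \<in> carrier E" for x
    using that h_inj by (simp add: k_def)
  define F :: "('b \<times> 'a) gr_bullet" where "F =
    \<lparr>carrier = h ` carrier E, mult = (\<lambda>u v. h (k u \<otimes>\<^bsub>E\<^esub> k v)), one = h \<one>\<^bsub>E\<^esub>, act = (\<lambda>u v. h (k u \<Up>\<^bsub>E\<^esub> k v))\<rparr>"
  have Fc: "carrier F = h ` carrier E" and Fo: "\<one>\<^bsub>F\<^esub> = h \<one>\<^bsub>E\<^esub>"
    and Fm: "\<And>x y. \<lbrakk>x \<in> carrier E; y \<in> carrier E\<rbrakk> \<Longrightarrow> h x \<otimes>\<^bsub>F\<^esub> h y = h (x \<otimes>\<^bsub>E\<^esub> y)"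
    and Fa: "\<And>x y. \<lbrakk>x \<in> carrier E; y \<in> carrier E\<rbrakk> \<Longrightarrow> h x \<Up>\<^bsub>F\<^esub> h y = h (x \<Up>\<^bsub>E\<^esub> y)"
    by (simp_all add: F_def kh)
  note Esimps = E.act_closed E.act_mult E.act_one E.mult_act
  have Fg: "group F"
  proof (rule groupI)
    fix u assume "u \<in> carrier F"
    then obtain x where x: "x \<in> carrier E" "u = h x" by (auto simp: Fc)
    then have "h (inv\<^bsub>E\<^esub> x) \<in> carrier F \<and> h (inv\<^bsub>E\<^esub> x) \<otimes>\<^bsub>F\<^esub> u = \<one>\<^bsub>F\<^esub>"
      by (simp add: Fc Fm Fo)
    then show "\<exists>v\<in>carrier F. v \<otimes>\<^bsub>F\<^esub> u = \<one>\<^bsub>F\<^esub>" by blast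
  qed (auto simp: Fc Fo Fm E.m_assoc)
  interpret Fg: group F by (rule Fg)
  have F: "gr_bullet F"
    by unfold_locales (auto simp: Fc Fo Fm Fa Esimps)
  have Finv: "inv\<^bsub>F\<^esub> (h x) = h (inv\<^bsub>E\<^esub> x)" if "x \<in> carrier E" for x
    by (rule Fg.inv_equality) (use that in \<open>auto simp: Fc Fo Fm\<close>)
  have "split_extension B A F (h \<circ> i) (p \<circ> k) (h \<circ> j)"
    unfolding split_extension_def
  proof (intro conjI)
    show "h \<circ> i \<in> gr_hom A F"
      by (auto simp: gr_hom_def hom_def Fc Fm Fa ic im iact)
    show "p \<circ> k \<in> gr_hom F B"
      by (auto simp: gr_hom_def hom_def Fc Fm Fa kh pact Esimps)
    show "h \<circ> j \<in> gr_hom B F"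
      by (auto simp: gr_hom_def hom_def Fc Fm Fa jact)
    show "inj_on (h \<circ> i) (carrier A)"
      using iinj h_inj ic by (auto intro!: comp_inj_on elim: inj_on_subset)
    have "(h \<circ> i) ` carrier A = h ` kernel E B p" by (simp only: image_comp[symmetric] iker)
    then show "(h \<circ> i) ` carrier A = kernel F B (p \<circ> k)"
      by (auto simp: kernel_def Fc kh)
    have "(p \<circ> k) ` carrier F = p ` carrier E"
      by (auto simp: Fc kh image_iff)
    then show "(p \<circ> k) ` carrier F = carrier B" using psurj by simp
    show "\<forall>b\<in>carrier B. (p \<circ> k) ((h \<circ> j) b) = b"
      by (simp add: kh pj)
  qed (rule F)
  moreover have "induced_actions B A F (h \<circ> i) (h \<circ> j) \<beta>"
    using ind by (simp add: induced_actions_def Fm Fa Finv ic Esimps)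
  ultimately show ?thesis unfolding derived_actions_def by blast
qed

(* For arbitrary maps \<beta>, the semidirect product being an object does not make \<beta> derived: its elements
   (\<one>, a) and (b, \<one>) need not recover \<beta>.  Here A and B are Z/2 with trivial action on itself and
   a^b = a + b, so even the two unit conditions hold.  Hence the hypothesis that every a \<mapsto> a^b fixes
   the zero of A, which is what a passage from the semidirect product back to \<beta> needs. *)
lemma semidirect_product_not_derived:
  defines "Z2 \<equiv> \<lparr>carrier = UNIV, mult = (\<noteq>), one = False, act = (\<lambda>g h. g)\<rparr> :: bool gr_bullet"
    and "\<beta> \<equiv> \<lparr>act_dot = (\<lambda>b a. a), act_star = (\<lambda>a b. a \<noteq> b), act_circ = (\<lambda>b a. False)\<rparr>"
  shows "gr_bullet Z2" and "triple_of_actions Z2 Z2 \<beta>"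
    and "gr_bullet (semidirect_product Z2 Z2 \<beta>)"
    and "\<forall>a\<in>carrier Z2. \<one>\<^bsub>Z2\<^esub> \<cdot>\<^bsub>\<beta>\<^esub> a = a \<and> a \<star>\<^bsub>\<beta>\<^esub> \<one>\<^bsub>Z2\<^esub> = a"
    and "\<not> action_conditions Z2 Z2 \<beta>" and "\<not> derived_actions Z2 Z2 \<beta>"
proof -
  have "group Z2" by (rule groupI) (auto simp: Z2_def)
  then show Z2: "gr_bullet Z2"
    by (intro gr_bullet.intro gr_bullet_axioms.intro) (auto simp: Z2_def)
  show "triple_of_actions Z2 Z2 \<beta>" by (simp add: triple_of_actions_def Z2_def)
  have "group (semidirect_product Z2 Z2 \<beta>)"
    by (rule groupI) (auto simp: semidirect_product_def Z2_def \<beta>_def)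
  then show "gr_bullet (semidirect_product Z2 Z2 \<beta>)"
    by (intro gr_bullet.intro gr_bullet_axioms.intro)
      (auto simp: semidirect_product_def Z2_def \<beta>_def)
  show "\<forall>a\<in>carrier Z2. \<one>\<^bsub>Z2\<^esub> \<cdot>\<^bsub>\<beta>\<^esub> a = a \<and> a \<star>\<^bsub>\<beta>\<^esub> \<one>\<^bsub>Z2\<^esub> = a"
    by (simp add: Z2_def \<beta>_def)
  show "\<not> action_conditions Z2 Z2 \<beta>"
    by (auto simp: action_conditions_def Z2_def \<beta>_def)
  show "\<not> derived_actions Z2 Z2 \<beta>"
  proof
    assume "derived_actions Z2 Z2 \<beta>"
    then obtain E :: "(bool \<times> bool) gr_bullet" and i p j where
      E: "gr_bullet E" and i: "i \<in> gr_hom Z2 E" "inj_on i UNIV" and j: "j \<in> gr_hom Z2 E"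
      and ind: "induced_actions Z2 Z2 E i j \<beta>"
      by (auto simp: derived_actions_def split_extension_def Z2_def)
    interpret E: gr_bullet E by (rule E)
    have ic: "i x \<in> carrier E" and jc: "j x \<in> carrier E" for x
      using i j by (auto simp: gr_hom_def hom_def Z2_def)
    have add: "i (x \<noteq> y) = i x \<otimes>\<^bsub>E\<^esub> i y" for x y
      using i by (auto simp: gr_hom_def hom_def Z2_def)
    have star: "i (x \<noteq> y) = i x \<Up>\<^bsub>E\<^esub> j y" for x y
      using ind by (auto simp: induced_actions_def Z2_def \<beta>_def)
    have "i True = i False \<Up>\<^bsub>E\<^esub> j True" using star[of False True] by simp
    also have "\<dots> = (i False \<otimes>\<^bsub>E\<^esub> i False) \<Up>\<^bsub>E\<^esub> j True" using add[of False False] by simp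
    also have "\<dots> = i True \<otimes>\<^bsub>E\<^esub> i True" using star[of False True] by (simp add: E.mult_act ic jc)
    also have "\<dots> = i False" using add[of True True] by simp
    finally show False using i(2) by (auto dest: injD)
  qed
qed

end

theory Submission
  imports Defs
begin

text \<open>
  In a split extension every element of \<open>E\<close> is uniquely a product \<open>i a \<otimes> j b\<close>, and the formulas for the
  induced actions are rules for bringing products and actions of such elements into this normal form:
  \<open>j b \<otimes> i a = i (b \<cdot> a) \<otimes> j b\<close>, \<open>j b \<Up> i a = i (b \<diamondop> a) \<otimes> j b\<close> and \<open>i a \<Up> j b = i (a \<star> b)\<close>.
  The action conditions are what these rules force on the triple: each of them arises from one element
  of \<open>E\<close> that reduces to its normal form along two routes, and comparing the results yields the condition
  because \<open>i\<close> is injective.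

  Conversely, the semidirect product is the set of normal forms with the operations that the rules
  dictate.  The action conditions turn its axioms into identities.  The elements \<open>(\<one>, a)\<close> and \<open>(b, \<one>)\<close>
  are copies of \<open>A\<close> and \<open>B\<close> that make it a split extension, and the unit axioms together with \<open>\<one> \<star> b = \<one>\<close> give exactly the unit laws by
  which this extension induces the given triple.  Since the action conditions contain \<open>\<one> \<star> b = \<one>\<close>
  (each \<open>a \<mapsto> a \<star> b\<close> is an endomorphism), they imply that the triple is derived.
\<close>

section \<open>Derived actions satisfy the action conditions\<close>

lemma gr_bullet_one_act:
  assumes "gr_bullet G" and "h \<in> carrier G"
  shows "\<one>\<^bsub>G\<^esub> \<Up>\<^bsub>G\<^esub> h = \<one>\<^bsub>G\<^esub>"
proof -
  interpret gr_bullet G by (rule assms(1))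
  have "(\<one>\<^bsub>G\<^esub> \<Up>\<^bsub>G\<^esub> h) \<otimes>\<^bsub>G\<^esub> (\<one>\<^bsub>G\<^esub> \<Up>\<^bsub>G\<^esub> h) = \<one>\<^bsub>G\<^esub> \<Up>\<^bsub>G\<^esub> h"
    using mult_act[of h "\<one>\<^bsub>G\<^esub>" "\<one>\<^bsub>G\<^esub>"] assms(2) by simp
  then show ?thesis using assms(2) by (simp add: act_closed)
qed

locale split_extension_with_actions =
  A: gr_bullet A + B: gr_bullet B + E: gr_bullet E
  for A :: "('a, 'n) gr_bullet_scheme" and B :: "('b, 'm) gr_bullet_scheme"
    and E :: "('e, 'k) gr_bullet_scheme"
    and i :: "'a \<Rightarrow> 'e" and p :: "'e \<Rightarrow> 'b" and j :: "'b \<Rightarrow> 'e"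
    and \<beta> :: "('b, 'a) action_triple" +
  assumes triple: "triple_of_actions B A \<beta>"
    and split: "split_extension B A E i p j"
    and induced: "induced_actions B A E i j \<beta>"
begin

lemma closed [simp]:
  assumes "a \<in> carrier A" and "b \<in> carrier B"
  shows "b \<cdot>\<^bsub>\<beta>\<^esub> a \<in> carrier A" and "a \<star>\<^bsub>\<beta>\<^esub> b \<in> carrier A" and "b \<diamondop>\<^bsub>\<beta>\<^esub> a \<in> carrier A"
  using triple assms by (auto simp: triple_of_actions_def)

lemma i_closed [simp]: "a \<in> carrier A \<Longrightarrow> i a \<in> carrier E"
  and i_mult: "\<lbrakk>a \<in> carrier A; a' \<in> carrier A\<rbrakk> \<Longrightarrow> i (a \<otimes>\<^bsub>A\<^esub> a') = i a \<otimes>\<^bsub>E\<^esub> i a'"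
  and i_act: "\<lbrakk>a \<in> carrier A; a' \<in> carrier A\<rbrakk> \<Longrightarrow> i (a \<Up>\<^bsub>A\<^esub> a') = i a \<Up>\<^bsub>E\<^esub> i a'"
  and j_closed [simp]: "b \<in> carrier B \<Longrightarrow> j b \<in> carrier E"
  and j_mult: "\<lbrakk>b \<in> carrier B; b' \<in> carrier B\<rbrakk> \<Longrightarrow> j (b \<otimes>\<^bsub>B\<^esub> b') = j b \<otimes>\<^bsub>E\<^esub> j b'"
  and j_act: "\<lbrakk>b \<in> carrier B; b' \<in> carrier B\<rbrakk> \<Longrightarrow> j (b \<Up>\<^bsub>B\<^esub> b') = j b \<Up>\<^bsub>E\<^esub> j b'"
  and i_inj: "inj_on i (carrier A)"
  using split by (auto simp: split_extension_def gr_hom_def hom_def)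

lemma j_one: "j \<one>\<^bsub>B\<^esub> = \<one>\<^bsub>E\<^esub>"
proof -
  have "j \<in> hom B E" using split by (simp add: split_extension_def gr_hom_def)
  then show ?thesis by (rule hom_one[OF _ B.is_group E.is_group])
qed

text \<open>The rules that carry an element of \<open>E\<close> to its normal form \<open>i a \<otimes> j b\<close>.\<close>

lemma normal_form_rules:
  assumes "a \<in> carrier A" and "b \<in> carrier B"
  shows "i (b \<cdot>\<^bsub>\<beta>\<^esub> a) \<otimes>\<^bsub>E\<^esub> j b = j b \<otimes>\<^bsub>E\<^esub> i a"
    and "i (b \<diamondop>\<^bsub>\<beta>\<^esub> a) \<otimes>\<^bsub>E\<^esub> j b = j b \<Up>\<^bsub>E\<^esub> i a"
    and "i (a \<star>\<^bsub>\<beta>\<^esub> b) = i a \<Up>\<^bsub>E\<^esub> j b"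
  using induced assms by (simp_all add: induced_actions_def E.m_assoc E.act_closed)

lemma normal_form_eqD:
  assumes "i a \<otimes>\<^bsub>E\<^esub> j b = i a' \<otimes>\<^bsub>E\<^esub> j b"
    and "a \<in> carrier A" and "a' \<in> carrier A" and "b \<in> carrier B"
  shows "a = a'"
  using assms i_inj by (auto dest: inj_onD)

text \<open>
  In each step below, a condition \<open>x = y\<close> is read off from the normal forms \<open>i x \<otimes> j b\<close> and \<open>i y \<otimes> j b\<close>
  of one element of \<open>E\<close>, or from \<open>i x = i y\<close> when that element lies in the image of \<open>i\<close>.
\<close>

lemma action_conditions: "action_conditions B A \<beta>"
proof -
  note E_closed [simp] = E.act_closed
  note A_closed [simp] = A.act_closed
  note B_closed [simp] = B.act_closed
  have i_eqD: "a = a'" if "i a = i a'" "a \<in> carrier A" "a' \<in> carrier A" for a a'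
    using that i_inj by (auto dest: inj_onD)
  have dot_mult: "b \<cdot>\<^bsub>\<beta>\<^esub> (a \<otimes>\<^bsub>A\<^esub> a') = (b \<cdot>\<^bsub>\<beta>\<^esub> a) \<otimes>\<^bsub>A\<^esub> (b \<cdot>\<^bsub>\<beta>\<^esub> a')"
    if [simp]: "b \<in> carrier B" "a \<in> carrier A" "a' \<in> carrier A" for b a a'
  proof (rule normal_form_eqD[where b = b])
    have "i (b \<cdot>\<^bsub>\<beta>\<^esub> (a \<otimes>\<^bsub>A\<^esub> a')) \<otimes>\<^bsub>E\<^esub> j b = (j b \<otimes>\<^bsub>E\<^esub> i a) \<otimes>\<^bsub>E\<^esub> i a'"
      by (simp add: normal_form_rules i_mult E.m_assoc)
    also have "\<dots> = i (b \<cdot>\<^bsub>\<beta>\<^esub> a) \<otimes>\<^bsub>E\<^esub> (j b \<otimes>\<^bsub>E\<^esub> i a')"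
      by (simp add: normal_form_rules(1)[symmetric] E.m_assoc)
    also have "\<dots> = i ((b \<cdot>\<^bsub>\<beta>\<^esub> a) \<otimes>\<^bsub>A\<^esub> (b \<cdot>\<^bsub>\<beta>\<^esub> a')) \<otimes>\<^bsub>E\<^esub> j b"
      by (simp add: normal_form_rules(1)[symmetric] i_mult E.m_assoc)
    finally show "i (b \<cdot>\<^bsub>\<beta>\<^esub> (a \<otimes>\<^bsub>A\<^esub> a')) \<otimes>\<^bsub>E\<^esub> j b
      = i ((b \<cdot>\<^bsub>\<beta>\<^esub> a) \<otimes>\<^bsub>A\<^esub> (b \<cdot>\<^bsub>\<beta>\<^esub> a')) \<otimes>\<^bsub>E\<^esub> j b" .
  qed simp_all
  have mult_dot: "(b \<otimes>\<^bsub>B\<^esub> b') \<cdot>\<^bsub>\<beta>\<^esub> a = b \<cdot>\<^bsub>\<beta>\<^esub> (b' \<cdot>\<^bsub>\<beta>\<^esub> a)"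
    if [simp]: "b \<in> carrier B" "b' \<in> carrier B" "a \<in> carrier A" for b b' a
  proof (rule normal_form_eqD[where b = "b \<otimes>\<^bsub>B\<^esub> b'"])
    have "i ((b \<otimes>\<^bsub>B\<^esub> b') \<cdot>\<^bsub>\<beta>\<^esub> a) \<otimes>\<^bsub>E\<^esub> j (b \<otimes>\<^bsub>B\<^esub> b') = j b \<otimes>\<^bsub>E\<^esub> (j b' \<otimes>\<^bsub>E\<^esub> i a)"
      by (simp only: normal_form_rules that B.m_closed) (simp add: j_mult E.m_assoc)
    also have "\<dots> = (j b \<otimes>\<^bsub>E\<^esub> i (b' \<cdot>\<^bsub>\<beta>\<^esub> a)) \<otimes>\<^bsub>E\<^esub> j b'"
      by (simp add: normal_form_rules(1)[symmetric, of a b'] E.m_assoc)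
    also have "\<dots> = i (b \<cdot>\<^bsub>\<beta>\<^esub> (b' \<cdot>\<^bsub>\<beta>\<^esub> a)) \<otimes>\<^bsub>E\<^esub> j (b \<otimes>\<^bsub>B\<^esub> b')"
      by (simp add: normal_form_rules(1)[symmetric] j_mult E.m_assoc)
    finally show "i ((b \<otimes>\<^bsub>B\<^esub> b') \<cdot>\<^bsub>\<beta>\<^esub> a) \<otimes>\<^bsub>E\<^esub> j (b \<otimes>\<^bsub>B\<^esub> b')
      = i (b \<cdot>\<^bsub>\<beta>\<^esub> (b' \<cdot>\<^bsub>\<beta>\<^esub> a)) \<otimes>\<^bsub>E\<^esub> j (b \<otimes>\<^bsub>B\<^esub> b')" .
  qed simp_all
  have one_dot: "\<one>\<^bsub>B\<^esub> \<cdot>\<^bsub>\<beta>\<^esub> a = a" if "a \<in> carrier A" for a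
    using normal_form_rules(1)[OF that B.one_closed] that by (auto intro: i_eqD simp: j_one)
  have star_one: "a \<star>\<^bsub>\<beta>\<^esub> \<one>\<^bsub>B\<^esub> = a" if "a \<in> carrier A" for a
    using normal_form_rules(3)[OF that B.one_closed] that
    by (auto intro: i_eqD simp: j_one E.act_one)
  have mult_star: "(a \<otimes>\<^bsub>A\<^esub> a') \<star>\<^bsub>\<beta>\<^esub> b = (a \<star>\<^bsub>\<beta>\<^esub> b) \<otimes>\<^bsub>A\<^esub> (a' \<star>\<^bsub>\<beta>\<^esub> b)"
    if [simp]: "a \<in> carrier A" "a' \<in> carrier A" "b \<in> carrier B" for a a' b
    by (rule i_eqD) (simp_all add: normal_form_rules i_mult E.mult_act)
  have star_mult: "a \<star>\<^bsub>\<beta>\<^esub> (b \<otimes>\<^bsub>B\<^esub> b') = (a \<star>\<^bsub>\<beta>\<^esub> b) \<star>\<^bsub>\<beta>\<^esub> b'"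
    if [simp]: "a \<in> carrier A" "b \<in> carrier B" "b' \<in> carrier B" for a b b'
    by (rule i_eqD) (simp_all add: normal_form_rules j_mult E.act_mult)
  have mult_circ: "(b \<otimes>\<^bsub>B\<^esub> b') \<diamondop>\<^bsub>\<beta>\<^esub> a = (b \<diamondop>\<^bsub>\<beta>\<^esub> a) \<otimes>\<^bsub>A\<^esub> (b \<cdot>\<^bsub>\<beta>\<^esub> (b' \<diamondop>\<^bsub>\<beta>\<^esub> a))"
    if [simp]: "b \<in> carrier B" "b' \<in> carrier B" "a \<in> carrier A" for b b' a
  proof (rule normal_form_eqD[where b = "b \<otimes>\<^bsub>B\<^esub> b'"])
    have "i ((b \<otimes>\<^bsub>B\<^esub> b') \<diamondop>\<^bsub>\<beta>\<^esub> a) \<otimes>\<^bsub>E\<^esub> j (b \<otimes>\<^bsub>B\<^esub> b') = (j b \<Up>\<^bsub>E\<^esub> i a) \<otimes>\<^bsub>E\<^esub> (j b' \<Up>\<^bsub>E\<^esub> i a)"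
      by (simp only: normal_form_rules that B.m_closed) (simp add: j_mult E.mult_act)
    also have "\<dots> = i (b \<diamondop>\<^bsub>\<beta>\<^esub> a) \<otimes>\<^bsub>E\<^esub> (j b \<otimes>\<^bsub>E\<^esub> i (b' \<diamondop>\<^bsub>\<beta>\<^esub> a)) \<otimes>\<^bsub>E\<^esub> j b'"
      by (simp add: normal_form_rules(2)[symmetric] E.m_assoc)
    also have "\<dots> = i ((b \<diamondop>\<^bsub>\<beta>\<^esub> a) \<otimes>\<^bsub>A\<^esub> (b \<cdot>\<^bsub>\<beta>\<^esub> (b' \<diamondop>\<^bsub>\<beta>\<^esub> a))) \<otimes>\<^bsub>E\<^esub> j (b \<otimes>\<^bsub>B\<^esub> b')"
      by (simp add: normal_form_rules(1)[symmetric] i_mult j_mult E.m_assoc)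
    finally show "i ((b \<otimes>\<^bsub>B\<^esub> b') \<diamondop>\<^bsub>\<beta>\<^esub> a) \<otimes>\<^bsub>E\<^esub> j (b \<otimes>\<^bsub>B\<^esub> b')
      = i ((b \<diamondop>\<^bsub>\<beta>\<^esub> a) \<otimes>\<^bsub>A\<^esub> (b \<cdot>\<^bsub>\<beta>\<^esub> (b' \<diamondop>\<^bsub>\<beta>\<^esub> a))) \<otimes>\<^bsub>E\<^esub> j (b \<otimes>\<^bsub>B\<^esub> b')" .
  qed simp_all
  have dot_act: "((b \<cdot>\<^bsub>\<beta>\<^esub> a) \<Up>\<^bsub>A\<^esub> a') \<otimes>\<^bsub>A\<^esub> (b \<diamondop>\<^bsub>\<beta>\<^esub> a') = (b \<diamondop>\<^bsub>\<beta>\<^esub> a') \<otimes>\<^bsub>A\<^esub> (b \<cdot>\<^bsub>\<beta>\<^esub> (a \<Up>\<^bsub>A\<^esub> a'))"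
    if [simp]: "b \<in> carrier B" "a \<in> carrier A" "a' \<in> carrier A" for b a a'
  proof (rule normal_form_eqD[where b = b])
    \<comment> \<open>Both sides reduce \<open>(j b \<otimes> i a) \<Up> i a'\<close>: the left one swaps the factors first.\<close>
    have "i (((b \<cdot>\<^bsub>\<beta>\<^esub> a) \<Up>\<^bsub>A\<^esub> a') \<otimes>\<^bsub>A\<^esub> (b \<diamondop>\<^bsub>\<beta>\<^esub> a')) \<otimes>\<^bsub>E\<^esub> j b
      = (i (b \<cdot>\<^bsub>\<beta>\<^esub> a) \<otimes>\<^bsub>E\<^esub> j b) \<Up>\<^bsub>E\<^esub> i a'"
      by (simp add: normal_form_rules(2) i_mult i_act E.m_assoc E.mult_act)
    also have "\<dots> = (j b \<Up>\<^bsub>E\<^esub> i a') \<otimes>\<^bsub>E\<^esub> i (a \<Up>\<^bsub>A\<^esub> a')"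
      by (simp add: normal_form_rules(1) i_act E.mult_act)
    also have "\<dots> = i (b \<diamondop>\<^bsub>\<beta>\<^esub> a') \<otimes>\<^bsub>E\<^esub> (j b \<otimes>\<^bsub>E\<^esub> i (a \<Up>\<^bsub>A\<^esub> a'))"
      by (simp add: normal_form_rules(2)[symmetric] E.m_assoc)
    also have "\<dots> = i ((b \<diamondop>\<^bsub>\<beta>\<^esub> a') \<otimes>\<^bsub>A\<^esub> (b \<cdot>\<^bsub>\<beta>\<^esub> (a \<Up>\<^bsub>A\<^esub> a'))) \<otimes>\<^bsub>E\<^esub> j b"
      by (simp add: normal_form_rules(1)[symmetric] i_mult E.m_assoc)
    finally show "i (((b \<cdot>\<^bsub>\<beta>\<^esub> a) \<Up>\<^bsub>A\<^esub> a') \<otimes>\<^bsub>A\<^esub> (b \<diamondop>\<^bsub>\<beta>\<^esub> a')) \<otimes>\<^bsub>E\<^esub> j b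
      = i ((b \<diamondop>\<^bsub>\<beta>\<^esub> a') \<otimes>\<^bsub>A\<^esub> (b \<cdot>\<^bsub>\<beta>\<^esub> (a \<Up>\<^bsub>A\<^esub> a'))) \<otimes>\<^bsub>E\<^esub> j b" .
  qed simp_all
  have dot_star: "(b \<cdot>\<^bsub>\<beta>\<^esub> a) \<star>\<^bsub>\<beta>\<^esub> b' = (b \<Up>\<^bsub>B\<^esub> b') \<cdot>\<^bsub>\<beta>\<^esub> (a \<star>\<^bsub>\<beta>\<^esub> b')"
    if [simp]: "b \<in> carrier B" "b' \<in> carrier B" "a \<in> carrier A" for b b' a
  proof (rule normal_form_eqD[where b = "b \<Up>\<^bsub>B\<^esub> b'"])
    \<comment> \<open>Both sides reduce \<open>(j b \<otimes> i a) \<Up> j b'\<close>.\<close>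
    have "i ((b \<cdot>\<^bsub>\<beta>\<^esub> a) \<star>\<^bsub>\<beta>\<^esub> b') \<otimes>\<^bsub>E\<^esub> j (b \<Up>\<^bsub>B\<^esub> b') = (i (b \<cdot>\<^bsub>\<beta>\<^esub> a) \<otimes>\<^bsub>E\<^esub> j b) \<Up>\<^bsub>E\<^esub> j b'"
      by (simp add: normal_form_rules(3) j_act E.mult_act)
    also have "\<dots> = j (b \<Up>\<^bsub>B\<^esub> b') \<otimes>\<^bsub>E\<^esub> i (a \<star>\<^bsub>\<beta>\<^esub> b')"
      by (simp add: normal_form_rules(1,3) j_act E.mult_act)
    also have "\<dots> = i ((b \<Up>\<^bsub>B\<^esub> b') \<cdot>\<^bsub>\<beta>\<^esub> (a \<star>\<^bsub>\<beta>\<^esub> b')) \<otimes>\<^bsub>E\<^esub> j (b \<Up>\<^bsub>B\<^esub> b')"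
      by (simp add: normal_form_rules(1))
    finally show "i ((b \<cdot>\<^bsub>\<beta>\<^esub> a) \<star>\<^bsub>\<beta>\<^esub> b') \<otimes>\<^bsub>E\<^esub> j (b \<Up>\<^bsub>B\<^esub> b')
      = i ((b \<Up>\<^bsub>B\<^esub> b') \<cdot>\<^bsub>\<beta>\<^esub> (a \<star>\<^bsub>\<beta>\<^esub> b')) \<otimes>\<^bsub>E\<^esub> j (b \<Up>\<^bsub>B\<^esub> b')" .
  qed simp_all
  have circ_mult: "b \<diamondop>\<^bsub>\<beta>\<^esub> (a \<otimes>\<^bsub>A\<^esub> a') = ((b \<diamondop>\<^bsub>\<beta>\<^esub> a) \<Up>\<^bsub>A\<^esub> a') \<otimes>\<^bsub>A\<^esub> (b \<diamondop>\<^bsub>\<beta>\<^esub> a')"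
    if [simp]: "b \<in> carrier B" "a \<in> carrier A" "a' \<in> carrier A" for b a a'
  proof (rule normal_form_eqD[where b = b])
    have "i (b \<diamondop>\<^bsub>\<beta>\<^esub> (a \<otimes>\<^bsub>A\<^esub> a')) \<otimes>\<^bsub>E\<^esub> j b = (j b \<Up>\<^bsub>E\<^esub> i a) \<Up>\<^bsub>E\<^esub> i a'"
      by (simp add: normal_form_rules(2) i_mult E.act_mult)
    also have "\<dots> = i ((b \<diamondop>\<^bsub>\<beta>\<^esub> a) \<Up>\<^bsub>A\<^esub> a') \<otimes>\<^bsub>E\<^esub> (j b \<Up>\<^bsub>E\<^esub> i a')"
      by (simp add: normal_form_rules(2)[symmetric, of a b] i_act E.mult_act)
    also have "\<dots> = i (((b \<diamondop>\<^bsub>\<beta>\<^esub> a) \<Up>\<^bsub>A\<^esub> a') \<otimes>\<^bsub>A\<^esub> (b \<diamondop>\<^bsub>\<beta>\<^esub> a')) \<otimes>\<^bsub>E\<^esub> j b"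
      by (simp add: normal_form_rules(2)[symmetric] i_mult E.m_assoc)
    finally show "i (b \<diamondop>\<^bsub>\<beta>\<^esub> (a \<otimes>\<^bsub>A\<^esub> a')) \<otimes>\<^bsub>E\<^esub> j b
      = i (((b \<diamondop>\<^bsub>\<beta>\<^esub> a) \<Up>\<^bsub>A\<^esub> a') \<otimes>\<^bsub>A\<^esub> (b \<diamondop>\<^bsub>\<beta>\<^esub> a')) \<otimes>\<^bsub>E\<^esub> j b" .
  qed simp_all
  have act_dot_star: "(a \<Up>\<^bsub>A\<^esub> (b \<cdot>\<^bsub>\<beta>\<^esub> a')) \<star>\<^bsub>\<beta>\<^esub> b = (a \<star>\<^bsub>\<beta>\<^esub> b) \<Up>\<^bsub>A\<^esub> a'"
    if [simp]: "b \<in> carrier B" "a \<in> carrier A" "a' \<in> carrier A" for b a a'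
  proof (rule i_eqD)
    \<comment> \<open>Both sides reduce \<open>i a \<Up> (j b \<otimes> i a')\<close>.\<close>
    have "i ((a \<Up>\<^bsub>A\<^esub> (b \<cdot>\<^bsub>\<beta>\<^esub> a')) \<star>\<^bsub>\<beta>\<^esub> b) = i a \<Up>\<^bsub>E\<^esub> (i (b \<cdot>\<^bsub>\<beta>\<^esub> a') \<otimes>\<^bsub>E\<^esub> j b)"
      by (simp add: normal_form_rules(3) i_act E.act_mult)
    also have "\<dots> = i ((a \<star>\<^bsub>\<beta>\<^esub> b) \<Up>\<^bsub>A\<^esub> a')"
      by (simp add: normal_form_rules(1,3) i_act E.act_mult)
    finally show "i ((a \<Up>\<^bsub>A\<^esub> (b \<cdot>\<^bsub>\<beta>\<^esub> a')) \<star>\<^bsub>\<beta>\<^esub> b) = i ((a \<star>\<^bsub>\<beta>\<^esub> b) \<Up>\<^bsub>A\<^esub> a')" .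
  qed simp_all
  have circ_dot_star: "(b \<diamondop>\<^bsub>\<beta>\<^esub> (b' \<cdot>\<^bsub>\<beta>\<^esub> a)) \<star>\<^bsub>\<beta>\<^esub> b' = (b \<Up>\<^bsub>B\<^esub> b') \<diamondop>\<^bsub>\<beta>\<^esub> a"
    if [simp]: "b \<in> carrier B" "b' \<in> carrier B" "a \<in> carrier A" for b b' a
  proof (rule normal_form_eqD[where b = "b \<Up>\<^bsub>B\<^esub> b'"])
    \<comment> \<open>Both sides reduce \<open>j b \<Up> (j b' \<otimes> i a)\<close>.\<close>
    have "i ((b \<diamondop>\<^bsub>\<beta>\<^esub> (b' \<cdot>\<^bsub>\<beta>\<^esub> a)) \<star>\<^bsub>\<beta>\<^esub> b') \<otimes>\<^bsub>E\<^esub> j (b \<Up>\<^bsub>B\<^esub> b')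
      = (i (b \<diamondop>\<^bsub>\<beta>\<^esub> (b' \<cdot>\<^bsub>\<beta>\<^esub> a)) \<otimes>\<^bsub>E\<^esub> j b) \<Up>\<^bsub>E\<^esub> j b'"
      by (simp add: normal_form_rules(3) j_act E.mult_act)
    also have "\<dots> = j b \<Up>\<^bsub>E\<^esub> (i (b' \<cdot>\<^bsub>\<beta>\<^esub> a) \<otimes>\<^bsub>E\<^esub> j b')"
      by (simp add: normal_form_rules(2) E.act_mult)
    also have "\<dots> = i ((b \<Up>\<^bsub>B\<^esub> b') \<diamondop>\<^bsub>\<beta>\<^esub> a) \<otimes>\<^bsub>E\<^esub> j (b \<Up>\<^bsub>B\<^esub> b')"
      by (simp add: normal_form_rules(1,2) j_act[symmetric] E.act_mult)
    finally show "i ((b \<diamondop>\<^bsub>\<beta>\<^esub> (b' \<cdot>\<^bsub>\<beta>\<^esub> a)) \<star>\<^bsub>\<beta>\<^esub> b') \<otimes>\<^bsub>E\<^esub> j (b \<Up>\<^bsub>B\<^esub> b')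
      = i ((b \<Up>\<^bsub>B\<^esub> b') \<diamondop>\<^bsub>\<beta>\<^esub> a) \<otimes>\<^bsub>E\<^esub> j (b \<Up>\<^bsub>B\<^esub> b')" .
  qed simp_all
  show ?thesis
    unfolding action_conditions_def
    by (intro conjI ballI dot_mult mult_dot one_dot star_one mult_star mult_circ dot_act dot_star
        circ_mult star_mult act_dot_star circ_dot_star)
qed

end

section \<open>The semidirect product\<close>

lemma semidirect_product_simps [simp]:
  "carrier (semidirect_product B A \<beta>) = carrier B \<times> carrier A"
  "\<one>\<^bsub>semidirect_product B A \<beta>\<^esub> = (\<one>\<^bsub>B\<^esub>, \<one>\<^bsub>A\<^esub>)"
  "(b, a) \<otimes>\<^bsub>semidirect_product B A \<beta>\<^esub> (b', a') = (b \<otimes>\<^bsub>B\<^esub> b', a \<otimes>\<^bsub>A\<^esub> (b \<cdot>\<^bsub>\<beta>\<^esub> a'))"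
  "(b, a) \<Up>\<^bsub>semidirect_product B A \<beta>\<^esub> (b', a') =
    (b \<Up>\<^bsub>B\<^esub> b', ((a \<Up>\<^bsub>A\<^esub> a') \<star>\<^bsub>\<beta>\<^esub> b') \<otimes>\<^bsub>A\<^esub> ((b \<diamondop>\<^bsub>\<beta>\<^esub> a') \<star>\<^bsub>\<beta>\<^esub> b'))"
  by (simp_all add: semidirect_product_def)

locale action_triple_on =
  A: gr_bullet A + B: gr_bullet B
  for A :: "('a, 'n) gr_bullet_scheme" and B :: "('b, 'm) gr_bullet_scheme"
    and \<beta> :: "('b, 'a) action_triple" +
  assumes triple: "triple_of_actions B A \<beta>"
begin

abbreviation "S \<equiv> semidirect_product B A \<beta>"

lemma closed [simp]:
  assumes "a \<in> carrier A" and "b \<in> carrier B"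
  shows "b \<cdot>\<^bsub>\<beta>\<^esub> a \<in> carrier A" and "a \<star>\<^bsub>\<beta>\<^esub> b \<in> carrier A" and "b \<diamondop>\<^bsub>\<beta>\<^esub> a \<in> carrier A"
  using triple assms by (auto simp: triple_of_actions_def)

lemma one_star_if_action_conditions:
  assumes "action_conditions B A \<beta>" and "b \<in> carrier B"
  shows "\<one>\<^bsub>A\<^esub> \<star>\<^bsub>\<beta>\<^esub> b = \<one>\<^bsub>A\<^esub>"
proof -
  have "(\<one>\<^bsub>A\<^esub> \<otimes>\<^bsub>A\<^esub> \<one>\<^bsub>A\<^esub>) \<star>\<^bsub>\<beta>\<^esub> b = (\<one>\<^bsub>A\<^esub> \<star>\<^bsub>\<beta>\<^esub> b) \<otimes>\<^bsub>A\<^esub> (\<one>\<^bsub>A\<^esub> \<star>\<^bsub>\<beta>\<^esub> b)"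
    using assms A.one_closed unfolding action_conditions_def by blast
  then show ?thesis using assms(2) by simp
qed

text \<open>
  The two action axioms both concern the second component
  \<open>(a \<Up> a' \<otimes> b \<diamondop> a') \<star> b'\<close> of \<open>(b, a) \<Up> (b', a')\<close>.  Since each \<open>a \<mapsto> a \<star> b\<close> is an
  endomorphism, it suffices to follow the inner expression \<open>a \<Up> a' \<otimes> b \<diamondop> a'\<close>, called \<open>c\<close> below.
\<close>

lemma gr_bullet_semidirect_product:
  assumes cond: "action_conditions B A \<beta>"
  shows "gr_bullet S"
proof -
  note cl [simp] = A.act_closed B.act_closed
  have dot_mult: "\<And>b a a'. \<lbrakk>b \<in> carrier B; a \<in> carrier A; a' \<in> carrier A\<rbrakk> \<Longrightarrow>
      b \<cdot>\<^bsub>\<beta>\<^esub> (a \<otimes>\<^bsub>A\<^esub> a') = (b \<cdot>\<^bsub>\<beta>\<^esub> a) \<otimes>\<^bsub>A\<^esub> (b \<cdot>\<^bsub>\<beta>\<^esub> a')"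
    and mult_dot: "\<And>b b' a. \<lbrakk>b \<in> carrier B; b' \<in> carrier B; a \<in> carrier A\<rbrakk> \<Longrightarrow>
      (b \<otimes>\<^bsub>B\<^esub> b') \<cdot>\<^bsub>\<beta>\<^esub> a = b \<cdot>\<^bsub>\<beta>\<^esub> (b' \<cdot>\<^bsub>\<beta>\<^esub> a)"
    and one_dot: "\<And>a. a \<in> carrier A \<Longrightarrow> \<one>\<^bsub>B\<^esub> \<cdot>\<^bsub>\<beta>\<^esub> a = a"
    and star_one: "\<And>a. a \<in> carrier A \<Longrightarrow> a \<star>\<^bsub>\<beta>\<^esub> \<one>\<^bsub>B\<^esub> = a"
    using cond unfolding action_conditions_def by blast+
  have mult_star: "\<And>a a' b. \<lbrakk>a \<in> carrier A; a' \<in> carrier A; b \<in> carrier B\<rbrakk> \<Longrightarrow>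
      (a \<otimes>\<^bsub>A\<^esub> a') \<star>\<^bsub>\<beta>\<^esub> b = (a \<star>\<^bsub>\<beta>\<^esub> b) \<otimes>\<^bsub>A\<^esub> (a' \<star>\<^bsub>\<beta>\<^esub> b)"
    and mult_circ: "\<And>b b' a. \<lbrakk>b \<in> carrier B; b' \<in> carrier B; a \<in> carrier A\<rbrakk> \<Longrightarrow>
      (b \<otimes>\<^bsub>B\<^esub> b') \<diamondop>\<^bsub>\<beta>\<^esub> a = (b \<diamondop>\<^bsub>\<beta>\<^esub> a) \<otimes>\<^bsub>A\<^esub> (b \<cdot>\<^bsub>\<beta>\<^esub> (b' \<diamondop>\<^bsub>\<beta>\<^esub> a))"
    and dot_act: "\<And>b a a'. \<lbrakk>b \<in> carrier B; a \<in> carrier A; a' \<in> carrier A\<rbrakk> \<Longrightarrow>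
      ((b \<cdot>\<^bsub>\<beta>\<^esub> a) \<Up>\<^bsub>A\<^esub> a') \<otimes>\<^bsub>A\<^esub> (b \<diamondop>\<^bsub>\<beta>\<^esub> a') = (b \<diamondop>\<^bsub>\<beta>\<^esub> a') \<otimes>\<^bsub>A\<^esub> (b \<cdot>\<^bsub>\<beta>\<^esub> (a \<Up>\<^bsub>A\<^esub> a'))"
    and dot_star: "\<And>b b' a. \<lbrakk>b \<in> carrier B; b' \<in> carrier B; a \<in> carrier A\<rbrakk> \<Longrightarrow>
      (b \<cdot>\<^bsub>\<beta>\<^esub> a) \<star>\<^bsub>\<beta>\<^esub> b' = (b \<Up>\<^bsub>B\<^esub> b') \<cdot>\<^bsub>\<beta>\<^esub> (a \<star>\<^bsub>\<beta>\<^esub> b')"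
    and circ_mult: "\<And>b a a'. \<lbrakk>b \<in> carrier B; a \<in> carrier A; a' \<in> carrier A\<rbrakk> \<Longrightarrow>
      b \<diamondop>\<^bsub>\<beta>\<^esub> (a \<otimes>\<^bsub>A\<^esub> a') = ((b \<diamondop>\<^bsub>\<beta>\<^esub> a) \<Up>\<^bsub>A\<^esub> a') \<otimes>\<^bsub>A\<^esub> (b \<diamondop>\<^bsub>\<beta>\<^esub> a')"
    and star_mult: "\<And>a b b'. \<lbrakk>a \<in> carrier A; b \<in> carrier B; b' \<in> carrier B\<rbrakk> \<Longrightarrow>
      a \<star>\<^bsub>\<beta>\<^esub> (b \<otimes>\<^bsub>B\<^esub> b') = (a \<star>\<^bsub>\<beta>\<^esub> b) \<star>\<^bsub>\<beta>\<^esub> b'"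
    and act_dot_star: "\<And>b a a'. \<lbrakk>b \<in> carrier B; a \<in> carrier A; a' \<in> carrier A\<rbrakk> \<Longrightarrow>
      (a \<Up>\<^bsub>A\<^esub> (b \<cdot>\<^bsub>\<beta>\<^esub> a')) \<star>\<^bsub>\<beta>\<^esub> b = (a \<star>\<^bsub>\<beta>\<^esub> b) \<Up>\<^bsub>A\<^esub> a'"
    and circ_dot_star: "\<And>b b' a. \<lbrakk>b \<in> carrier B; b' \<in> carrier B; a \<in> carrier A\<rbrakk> \<Longrightarrow>
      (b \<diamondop>\<^bsub>\<beta>\<^esub> (b' \<cdot>\<^bsub>\<beta>\<^esub> a)) \<star>\<^bsub>\<beta>\<^esub> b' = (b \<Up>\<^bsub>B\<^esub> b') \<diamondop>\<^bsub>\<beta>\<^esub> a"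
    using cond unfolding action_conditions_def by (blast+)
  have dot_one: "b \<cdot>\<^bsub>\<beta>\<^esub> \<one>\<^bsub>A\<^esub> = \<one>\<^bsub>A\<^esub>" if "b \<in> carrier B" for b
    using dot_mult[of b "\<one>\<^bsub>A\<^esub>" "\<one>\<^bsub>A\<^esub>"] that by simp
  have circ_one: "b \<diamondop>\<^bsub>\<beta>\<^esub> \<one>\<^bsub>A\<^esub> = \<one>\<^bsub>A\<^esub>" if "b \<in> carrier B" for b
    using circ_mult[of b "\<one>\<^bsub>A\<^esub>" "\<one>\<^bsub>A\<^esub>"] that by (simp add: A.act_one)
  have "group S"
  proof (rule groupI)
    fix x assume "x \<in> carrier S"
    then obtain b a where x: "x = (b, a)" "b \<in> carrier B" "a \<in> carrier A" by auto
    let ?y = "(inv\<^bsub>B\<^esub> b, inv\<^bsub>B\<^esub> b \<cdot>\<^bsub>\<beta>\<^esub> inv\<^bsub>A\<^esub> a)"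
    have "?y \<in> carrier S" and "?y \<otimes>\<^bsub>S\<^esub> x = \<one>\<^bsub>S\<^esub>"
      using x by (simp_all add: dot_mult[symmetric] dot_one)
    then show "\<exists>y\<in>carrier S. y \<otimes>\<^bsub>S\<^esub> x = \<one>\<^bsub>S\<^esub>" by blast
  qed (auto simp: A.m_assoc B.m_assoc dot_mult mult_dot one_dot)
  moreover have "gr_bullet_axioms S"
  proof
    fix x y assume "x \<in> carrier S" "y \<in> carrier S"
    then show "x \<Up>\<^bsub>S\<^esub> y \<in> carrier S" by auto
  next
    fix x assume "x \<in> carrier S"
    then show "x \<Up>\<^bsub>S\<^esub> \<one>\<^bsub>S\<^esub> = x"
      by (auto simp: A.act_one B.act_one star_one circ_one)
  next
    fix x y z assume "x \<in> carrier S" "y \<in> carrier S" "z \<in> carrier S"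
    then obtain b a b' a' b'' a'' where xyz: "x = (b, a)" "y = (b', a')" "z = (b'', a'')"
      and [simp]: "b \<in> carrier B" "a \<in> carrier A" "b' \<in> carrier B" "a' \<in> carrier A"
        "b'' \<in> carrier B" "a'' \<in> carrier A"
      by auto
    define c where "c = (a \<Up>\<^bsub>A\<^esub> a') \<otimes>\<^bsub>A\<^esub> (b \<diamondop>\<^bsub>\<beta>\<^esub> a')"
    have [simp]: "c \<in> carrier A" by (simp add: c_def)
    have c: "(a \<Up>\<^bsub>A\<^esub> (a' \<otimes>\<^bsub>A\<^esub> d)) \<otimes>\<^bsub>A\<^esub> (b \<diamondop>\<^bsub>\<beta>\<^esub> (a' \<otimes>\<^bsub>A\<^esub> d))
        = (c \<Up>\<^bsub>A\<^esub> d) \<otimes>\<^bsub>A\<^esub> (b \<diamondop>\<^bsub>\<beta>\<^esub> d)" if "d \<in> carrier A" for d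
      using that by (simp add: c_def A.act_mult A.mult_act circ_mult A.m_assoc)
    have "x \<Up>\<^bsub>S\<^esub> (y \<otimes>\<^bsub>S\<^esub> z) = (b \<Up>\<^bsub>B\<^esub> (b' \<otimes>\<^bsub>B\<^esub> b''),
        ((a \<Up>\<^bsub>A\<^esub> (a' \<otimes>\<^bsub>A\<^esub> (b' \<cdot>\<^bsub>\<beta>\<^esub> a''))) \<otimes>\<^bsub>A\<^esub> (b \<diamondop>\<^bsub>\<beta>\<^esub> (a' \<otimes>\<^bsub>A\<^esub> (b' \<cdot>\<^bsub>\<beta>\<^esub> a''))))
          \<star>\<^bsub>\<beta>\<^esub> (b' \<otimes>\<^bsub>B\<^esub> b''))"
      by (simp add: xyz mult_star)
    also have "\<dots> = ((b \<Up>\<^bsub>B\<^esub> b') \<Up>\<^bsub>B\<^esub> b'',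
        ((c \<star>\<^bsub>\<beta>\<^esub> b') \<Up>\<^bsub>A\<^esub> a'' \<otimes>\<^bsub>A\<^esub> ((b \<Up>\<^bsub>B\<^esub> b') \<diamondop>\<^bsub>\<beta>\<^esub> a'')) \<star>\<^bsub>\<beta>\<^esub> b'')"
      by (simp add: c B.act_mult star_mult mult_star act_dot_star circ_dot_star)
    also have "\<dots> = (x \<Up>\<^bsub>S\<^esub> y) \<Up>\<^bsub>S\<^esub> z"
      by (simp add: xyz c_def mult_star)
    finally show "x \<Up>\<^bsub>S\<^esub> (y \<otimes>\<^bsub>S\<^esub> z) = (x \<Up>\<^bsub>S\<^esub> y) \<Up>\<^bsub>S\<^esub> z" .
  next
    fix z x y assume "x \<in> carrier S" "y \<in> carrier S" "z \<in> carrier S"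
    then obtain b a b' a' b'' a'' where xyz: "x = (b, a)" "y = (b', a')" "z = (b'', a'')"
      and [simp]: "b \<in> carrier B" "a \<in> carrier A" "b' \<in> carrier B" "a' \<in> carrier A"
        "b'' \<in> carrier B" "a'' \<in> carrier A"
      by auto
    define c c' where "c = (a \<Up>\<^bsub>A\<^esub> a'') \<otimes>\<^bsub>A\<^esub> (b \<diamondop>\<^bsub>\<beta>\<^esub> a'')"
      and "c' = (a' \<Up>\<^bsub>A\<^esub> a'') \<otimes>\<^bsub>A\<^esub> (b' \<diamondop>\<^bsub>\<beta>\<^esub> a'')"
    have [simp]: "c \<in> carrier A" "c' \<in> carrier A" by (simp_all add: c_def c'_def)
    have "((a \<otimes>\<^bsub>A\<^esub> (b \<cdot>\<^bsub>\<beta>\<^esub> a')) \<Up>\<^bsub>A\<^esub> a'') \<otimes>\<^bsub>A\<^esub> ((b \<otimes>\<^bsub>B\<^esub> b') \<diamondop>\<^bsub>\<beta>\<^esub> a'')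
        = (a \<Up>\<^bsub>A\<^esub> a'') \<otimes>\<^bsub>A\<^esub> (((b \<cdot>\<^bsub>\<beta>\<^esub> a') \<Up>\<^bsub>A\<^esub> a'') \<otimes>\<^bsub>A\<^esub> (b \<diamondop>\<^bsub>\<beta>\<^esub> a''))
            \<otimes>\<^bsub>A\<^esub> (b \<cdot>\<^bsub>\<beta>\<^esub> (b' \<diamondop>\<^bsub>\<beta>\<^esub> a''))"
      by (simp add: A.mult_act mult_circ A.m_assoc)
    also have "\<dots> = c \<otimes>\<^bsub>A\<^esub> (b \<cdot>\<^bsub>\<beta>\<^esub> c')"
      by (simp add: dot_act c_def c'_def dot_mult A.m_assoc)
    finally have c: "((a \<otimes>\<^bsub>A\<^esub> (b \<cdot>\<^bsub>\<beta>\<^esub> a')) \<Up>\<^bsub>A\<^esub> a'') \<otimes>\<^bsub>A\<^esub> ((b \<otimes>\<^bsub>B\<^esub> b') \<diamondop>\<^bsub>\<beta>\<^esub> a'')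
        = c \<otimes>\<^bsub>A\<^esub> (b \<cdot>\<^bsub>\<beta>\<^esub> c')" .
    have "(x \<otimes>\<^bsub>S\<^esub> y) \<Up>\<^bsub>S\<^esub> z = ((b \<otimes>\<^bsub>B\<^esub> b') \<Up>\<^bsub>B\<^esub> b'', (c \<otimes>\<^bsub>A\<^esub> (b \<cdot>\<^bsub>\<beta>\<^esub> c')) \<star>\<^bsub>\<beta>\<^esub> b'')"
      unfolding c[symmetric] by (simp add: xyz mult_star)
    also have "\<dots> = ((b \<Up>\<^bsub>B\<^esub> b'') \<otimes>\<^bsub>B\<^esub> (b' \<Up>\<^bsub>B\<^esub> b''),
        (c \<star>\<^bsub>\<beta>\<^esub> b'') \<otimes>\<^bsub>A\<^esub> ((b \<Up>\<^bsub>B\<^esub> b'') \<cdot>\<^bsub>\<beta>\<^esub> (c' \<star>\<^bsub>\<beta>\<^esub> b'')))"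
      by (simp add: B.mult_act mult_star dot_star)
    also have "\<dots> = (x \<Up>\<^bsub>S\<^esub> z) \<otimes>\<^bsub>S\<^esub> (y \<Up>\<^bsub>S\<^esub> z)"
      by (simp add: xyz c_def c'_def mult_star)
    finally show "(x \<otimes>\<^bsub>S\<^esub> y) \<Up>\<^bsub>S\<^esub> z = (x \<Up>\<^bsub>S\<^esub> z) \<otimes>\<^bsub>S\<^esub> (y \<Up>\<^bsub>S\<^esub> z)" .
  qed
  ultimately show ?thesis by (rule gr_bullet.intro)
qed

text \<open>
  Multiplying and acting with pairs that have a trivial component gives the unit laws
  \<open>b \<cdot> \<one> = \<one>\<close>, \<open>\<one> \<cdot> a = a\<close>, \<open>a \<star> \<one> = a\<close>, \<open>b \<diamondop> \<one> = \<one>\<close> and \<open>\<one> \<diamondop> a = \<one>\<close>, and with \<open>\<one> \<star> b = \<one>\<close> they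
  are all that the canonical inclusions and the projection need.  The axiom \<open>(b, a) \<Up> \<one> = (b, a)\<close> yields only
  \<open>(a \<star> \<one>) \<otimes> ((b \<diamondop> \<one>) \<star> \<one>) = a\<close>; the hypothesis \<open>\<one> \<star> b = \<one>\<close> separates the two factors.
\<close>

lemma derived_actions_if_semidirect_product:
  assumes S: "gr_bullet S" and one_star: "\<And>b. b \<in> carrier B \<Longrightarrow> \<one>\<^bsub>A\<^esub> \<star>\<^bsub>\<beta>\<^esub> b = \<one>\<^bsub>A\<^esub>"
  shows "derived_actions B A \<beta>"
proof -
  interpret S: gr_bullet S by (rule S)
  note one_act = gr_bullet_one_act[OF A.gr_bullet_axioms] gr_bullet_one_act[OF B.gr_bullet_axioms]
  have dot_one: "b \<cdot>\<^bsub>\<beta>\<^esub> \<one>\<^bsub>A\<^esub> = \<one>\<^bsub>A\<^esub>" if "b \<in> carrier B" for b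
    using S.r_one[of "(b, \<one>\<^bsub>A\<^esub>)"] that by simp
  have one_dot: "\<one>\<^bsub>B\<^esub> \<cdot>\<^bsub>\<beta>\<^esub> a = a" if "a \<in> carrier A" for a
    using S.l_one[of "(\<one>\<^bsub>B\<^esub>, a)"] that by simp
  have circ_one_star: "(b \<diamondop>\<^bsub>\<beta>\<^esub> \<one>\<^bsub>A\<^esub>) \<star>\<^bsub>\<beta>\<^esub> \<one>\<^bsub>B\<^esub> = \<one>\<^bsub>A\<^esub>" if "b \<in> carrier B" for b
    using S.act_one[of "(b, \<one>\<^bsub>A\<^esub>)"] that by (simp add: one_star A.act_one)
  have star_one: "a \<star>\<^bsub>\<beta>\<^esub> \<one>\<^bsub>B\<^esub> = a" if "a \<in> carrier A" for a
    using S.act_one[of "(\<one>\<^bsub>B\<^esub>, a)"] that by (simp add: circ_one_star A.act_one)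
  have circ_one: "b \<diamondop>\<^bsub>\<beta>\<^esub> \<one>\<^bsub>A\<^esub> = \<one>\<^bsub>A\<^esub>" if "b \<in> carrier B" for b
    using circ_one_star that by (simp add: star_one)
  have one_circ: "\<one>\<^bsub>B\<^esub> \<diamondop>\<^bsub>\<beta>\<^esub> a = \<one>\<^bsub>A\<^esub>" if "a \<in> carrier A" for a
    using gr_bullet_one_act[OF S, of "(\<one>\<^bsub>B\<^esub>, a)"] that by (simp add: one_star star_one one_act)
  define i where "i a = (\<one>\<^bsub>B\<^esub>, a)" for a :: 'a
  define j where "j b = (b, \<one>\<^bsub>A\<^esub>)" for b :: 'b
  have "split_extension B A S i fst j"
    unfolding split_extension_def
  proof (intro conjI S)
    show "i \<in> gr_hom A S"
      by (auto simp: gr_hom_def hom_def i_def one_dot star_one one_circ A.act_closed one_act)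
    show "fst \<in> gr_hom S B" and "j \<in> gr_hom B S"
      by (auto simp: gr_hom_def hom_def j_def dot_one circ_one one_star A.act_one)
    show "inj_on i (carrier A)" by (auto simp: inj_on_def i_def)
    show "i ` carrier A = kernel S B fst" by (auto simp: kernel_def i_def)
    show "fst ` carrier S = carrier B" by force
    show "\<forall>b\<in>carrier B. fst (j b) = b" by (simp add: j_def)
  qed
  moreover have "induced_actions B A S i j \<beta>"
    unfolding induced_actions_def
  proof (intro ballI conjI)
    fix b a assume [simp]: "b \<in> carrier B" "a \<in> carrier A"
    have jb: "j b \<in> carrier S" by (simp add: j_def)
    have ij: "i a' \<otimes>\<^bsub>S\<^esub> j b = (b, a')" if "a' \<in> carrier A" for a'
      using that by (simp add: i_def j_def one_dot)
    have divide: "i a' = x \<otimes>\<^bsub>S\<^esub> inv\<^bsub>S\<^esub> (j b)" if "a' \<in> carrier A" "x = (b, a')" for a' x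
      using that jb by (subst S.inv_solve_right) (simp_all add: ij, simp add: i_def)
    show "i (b \<cdot>\<^bsub>\<beta>\<^esub> a) = j b \<otimes>\<^bsub>S\<^esub> i a \<otimes>\<^bsub>S\<^esub> inv\<^bsub>S\<^esub> (j b)"
      by (rule divide) (simp_all add: i_def j_def)
    show "i (b \<diamondop>\<^bsub>\<beta>\<^esub> a) = (j b \<Up>\<^bsub>S\<^esub> i a) \<otimes>\<^bsub>S\<^esub> inv\<^bsub>S\<^esub> (j b)"
      by (rule divide) (simp_all add: i_def j_def one_act star_one B.act_one)
    show "i (a \<star>\<^bsub>\<beta>\<^esub> b) = i a \<Up>\<^bsub>S\<^esub> j b"
      by (simp add: i_def j_def one_act circ_one one_star A.act_one)
  qed
  ultimately show ?thesis unfolding derived_actions_def by blast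
qed

end

section \<open>The equivalence\<close>

theorem theorem3p2:
  fixes A :: "'a gr_bullet" and B :: "'b gr_bullet" and \<beta> :: "('b, 'a) action_triple"
  assumes "gr_bullet A" and "gr_bullet B" and "triple_of_actions B A \<beta>"
  shows "(derived_actions B A \<beta> \<longleftrightarrow> action_conditions B A \<beta>) \<and>
    (action_conditions B A \<beta> \<longrightarrow> gr_bullet (semidirect_product B A \<beta>)) \<and>
    ((\<forall>b\<in>carrier B. \<one>\<^bsub>A\<^esub> \<star>\<^bsub>\<beta>\<^esub> b = \<one>\<^bsub>A\<^esub>) \<longrightarrow>
      gr_bullet (semidirect_product B A \<beta>) \<longrightarrow> derived_actions B A \<beta>)"
proof -
  interpret action_triple_on A B \<beta>
    using assms by (simp add: action_triple_on_def action_triple_on_axioms_def)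
  have "action_conditions B A \<beta>" if "derived_actions B A \<beta>"
  proof -
    obtain E :: "('b \<times> 'a) gr_bullet" and i p j
      where "split_extension B A E i p j" "induced_actions B A E i j \<beta>"
      using \<open>derived_actions B A \<beta>\<close> unfolding derived_actions_def by blast
    then interpret split_extension_with_actions A B E i p j \<beta>
      using assms
      by (simp add: split_extension_with_actions_def split_extension_with_actions_axioms_def
          split_extension_def)
    show ?thesis by (rule action_conditions)
  qed
  moreover have "derived_actions B A \<beta>" if "action_conditions B A \<beta>"
    using that
    by (intro derived_actions_if_semidirect_product gr_bullet_semidirect_product
        one_star_if_action_conditions)
  ultimately show ?thesis
    using gr_bullet_semidirect_product derived_actions_if_semidirect_product by blast
qed

end
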